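(* Let $S$ be a stable, regular partial semigroup with $\mathscr J=\mathscr D$-classes $\{D_q:q\in Q\}$, and for each $q\in Q$ fix a group $\mathscr H$-class $G_q$ in $D_q$. Then the set $\operatorname{Cong}_{\mathscr H}(S)$ of all congruences on $S$ contained in Green's relation $\mathscr H$ is $$\operatorname{Cong}_{\mathscr H}(S)=\{\Theta^S(\mathbf N):\mathbf N\text{ is an NZ-tuple}\},\qquad\text{where}\quad \Theta^S(\mathbf N)=\bigcup_{q\in Q}\nu_{N_q}\ \text{ for }\ \mathbf N=(N_q)_{q\in Q}.$$
   Context: **Partial semigroups.** A partial semigroup is a 5-tuple $(S,\mathscr C,\mathbf d,\mathbf r,\cdot)$ with $\mathbf d,\mathbf r:S\to\mathscr C$ and $\cdot$ a partial binary operation on $S$ such that $xy$ is defined iff $\mathbf r(x)=\mathbf d(y)$, in which case $\mathbf d(xy)=\mathbf d(x)$ and $\mathbf r(xy)=\mathbf r(y)$, and $(xy)z=x(yz)$ whenever $xy$ and $yz$ are defined. $S^1$ is the category obtained by adjoining identities at objects where needed. $S$ is regular if every $x\in S$ satisfies $x=xax$ for some $a\in S$. Green's relations: $x\mathrel{\mathscr R}y\Leftrightarrow xS^1=yS^1$, $x\mathrel{\mathscr L}y\Leftrightarrow S^1x=S^1y$, $x\mathrel{\mathscr J}y\Leftrightarrow S^1xS^1=S^1yS^1$, $\mathscr H=\mathscr R\cap\mathscr L$, $\mathscr D=\mathscr R\vee\mathscr L$; $\mathscr J$-classes are ordered by $J_x\le J_y\Leftrightarrow x\in S^1yS^1$.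 $S$ is stable if for all $x,a\in S$: $(x,xa)\in\mathscr J\Rightarrow(x,xa)\in\mathscr R$ and $(x,ax)\in\mathscr J\Rightarrow(x,ax)\in\mathscr L$ (when the products are defined); then $\mathscr J=\mathscr D$. A congruence on $S$ is an equivalence $\sigma$ such that $(x,y)\in\sigma$ implies $\mathbf d(x)=\mathbf d(y)$ and $\mathbf r(x)=\mathbf r(y)$, and compatible with all defined left and right multiplications. $\Omega^\sharp$ is the congruence on $S$ generated by $\Omega$. **Relations $\nu_N$.** For a normal subgroup $N\unlhd G_q$, $\nu_N=\{(axb,ayb):x,y\in N,\ a,b\in S^1,\ axb,ayb\in D_q\}$ (an equivalence on $D_q$ contained in $\mathscr H$). **NZ-tuples.** Order $Q$ by $p\le q\Leftrightarrow D_p\le D_q$. Let $\zeta$ be the largest congruence on $S$ contained in $\mathscr H$. For $q\in Q$, $Z_q\unlhd G_q$ is the normal subgroup with $\zeta{\restriction}_{D_q}=\nu_{Z_q}$, i.e. $Z_q=\{g\in G_q:(\mathrm{id}_{G_q},g)\in\zeta\}$. For $p\le q$ and $N\unlhd G_q$ with $N\le Z_q$, $N^{\downarrow_p}\unlhd G_p$ is the normal subgroup with $\nu_N^\sharp{\restriction}_{D_p}=\nu_{N^{\downarrow_p}}$, i.e. $N^{\downarrow_p}=\{g\in G_p:(\mathrm{id}_{G_p},g)\in\nu_N^\sharp\}$. A tuple $\mathbf N=(N_q)_{q\in Q}$ is an NZ-tuple if $N_q\unlhd G_q$ and $N_q\le Z_q$ for all $q\in Q$, and $N_q^{\downarrow_p}\le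 N_p$ for all $p\le q$ in $Q$. *)

theory Defs
  imports "HOL-Algebra.Coset"
begin

(* The partial product is encoded by a total function psg_mult that carries meaning only on
   composable pairs of elements; every definition below guards its products accordingly. *)
record ('a, 'c) psg =
  elems :: "'a set"
  objs :: "'c set"
  dd :: "'a \<Rightarrow> 'c"
  rr :: "'a \<Rightarrow> 'c"
  psg_mult :: "'a \<Rightarrow> 'a \<Rightarrow> 'a"  (infixl "\<cdot>\<index>" 70)

definition composable :: "('a, 'c, 'm) psg_scheme \<Rightarrow> 'a \<Rightarrow> 'a \<Rightarrow> bool" where
  "composable S x y \<longleftrightarrow> rr S x = dd S y"

definition partial_semigroup :: "('a, 'c, 'm) psg_scheme \<Rightarrow> bool" where
  "partial_semigroup S \<longleftrightarrow>
     dd S \<in> elems S \<rightarrow> objs S \<and> rr S \<in> elems S \<rightarrow> objs S \<and>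
     (\<forall>x\<in>elems S. \<forall>y\<in>elems S. composable S x y \<longrightarrow>
        x \<cdot>\<^bsub>S\<^esub> y \<in> elems S \<and>
        dd S (x \<cdot>\<^bsub>S\<^esub> y) = dd S x \<and> rr S (x \<cdot>\<^bsub>S\<^esub> y) = rr S y) \<and>
     (\<forall>x\<in>elems S. \<forall>y\<in>elems S. \<forall>z\<in>elems S. composable S x y \<longrightarrow> composable S y z \<longrightarrow>
        (x \<cdot>\<^bsub>S\<^esub> y) \<cdot>\<^bsub>S\<^esub> z = x \<cdot>\<^bsub>S\<^esub> (y \<cdot>\<^bsub>S\<^esub> z))"

definition identity_at :: "('a, 'c, 'm) psg_scheme \<Rightarrow> 'c \<Rightarrow> 'a \<Rightarrow> bool" where
  "identity_at S c e \<longleftrightarrow> e \<in> elems S \<and> dd S e = c \<and> rr S e = c \<and>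
     (\<forall>x\<in>elems S. dd S x = c \<longrightarrow> e \<cdot>\<^bsub>S\<^esub> x = x) \<and>
     (\<forall>x\<in>elems S. rr S x = c \<longrightarrow> x \<cdot>\<^bsub>S\<^esub> e = x)"

fun mult_adj :: "('a, 'c, 'm) psg_scheme \<Rightarrow> 'a + 'c \<Rightarrow> 'a + 'c \<Rightarrow> 'a + 'c" where
  "mult_adj S (Inl x) (Inl y) = Inl (x \<cdot>\<^bsub>S\<^esub> y)"
| "mult_adj S (Inl x) (Inr c) = Inl x"
| "mult_adj S (Inr c) y = y"

(* The category S^1: Inl embeds S, and Inr c is a new identity at the object c, adjoined
   exactly when S has no identity at c. *)
definition adjoin_ids :: "('a, 'c, 'm) psg_scheme \<Rightarrow> ('a + 'c, 'c) psg" where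
  "adjoin_ids S =
     \<lparr> elems = Inl ` elems S \<union> Inr ` {c \<in> objs S. \<not> (\<exists>e. identity_at S c e)},
       objs = objs S,
       dd = case_sum (dd S) (\<lambda>c. c),
       rr = case_sum (rr S) (\<lambda>c. c),
       psg_mult = mult_adj S \<rparr>"

definition regular_psg :: "('a, 'c, 'm) psg_scheme \<Rightarrow> bool" where
  "regular_psg S \<longleftrightarrow> (\<forall>x\<in>elems S. \<exists>a\<in>elems S. composable S x a \<and> composable S a x \<and>
     x = x \<cdot>\<^bsub>S\<^esub> a \<cdot>\<^bsub>S\<^esub> x)"

(* The principal ideals x S^1, S^1 x and S^1 x S^1, as subsets of S^1. *)
definition right_ideal :: "('a, 'c, 'm) psg_scheme \<Rightarrow> 'a \<Rightarrow> ('a + 'c) set" where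
  "right_ideal S x = (let T = adjoin_ids S in
     {Inl x \<cdot>\<^bsub>T\<^esub> a | a. a \<in> elems T \<and> composable T (Inl x) a})"

definition left_ideal :: "('a, 'c, 'm) psg_scheme \<Rightarrow> 'a \<Rightarrow> ('a + 'c) set" where
  "left_ideal S x = (let T = adjoin_ids S in
     {a \<cdot>\<^bsub>T\<^esub> Inl x | a. a \<in> elems T \<and> composable T a (Inl x)})"

definition two_sided_ideal :: "('a, 'c, 'm) psg_scheme \<Rightarrow> 'a \<Rightarrow> ('a + 'c) set" where
  "two_sided_ideal S x = (let T = adjoin_ids S in
     {a \<cdot>\<^bsub>T\<^esub> Inl x \<cdot>\<^bsub>T\<^esub> b | a b. a \<in> elems T \<and> b \<in> elems T \<and>
        composable T a (Inl x) \<and> composable T (Inl x) b})"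

definition green_R :: "('a, 'c, 'm) psg_scheme \<Rightarrow> ('a \<times> 'a) set" where
  "green_R S = {(x, y) \<in> elems S \<times> elems S. right_ideal S x = right_ideal S y}"

definition green_L :: "('a, 'c, 'm) psg_scheme \<Rightarrow> ('a \<times> 'a) set" where
  "green_L S = {(x, y) \<in> elems S \<times> elems S. left_ideal S x = left_ideal S y}"

definition green_J :: "('a, 'c, 'm) psg_scheme \<Rightarrow> ('a \<times> 'a) set" where
  "green_J S = {(x, y) \<in> elems S \<times> elems S. two_sided_ideal S x = two_sided_ideal S y}"

definition green_H :: "('a, 'c, 'm) psg_scheme \<Rightarrow> ('a \<times> 'a) set" where
  "green_H S = green_R S \<inter> green_L S"

(* The join of R and L in the lattice of equivalences on the elements of S. *)
definition green_D :: "('a, 'c, 'm) psg_scheme \<Rightarrow> ('a \<times> 'a) set" where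
  "green_D S = \<Inter> {E. equiv (elems S) E \<and> green_R S \<subseteq> E \<and> green_L S \<subseteq> E}"

definition J_class_le :: "('a, 'c, 'm) psg_scheme \<Rightarrow> 'a set \<Rightarrow> 'a set \<Rightarrow> bool" where
  "J_class_le S A B \<longleftrightarrow> (\<exists>x\<in>elems S. \<exists>y\<in>elems S.
     A = green_J S `` {x} \<and> B = green_J S `` {y} \<and> Inl x \<in> two_sided_ideal S y)"

definition stable_psg :: "('a, 'c, 'm) psg_scheme \<Rightarrow> bool" where
  "stable_psg S \<longleftrightarrow> (\<forall>x\<in>elems S. \<forall>a\<in>elems S.
     (composable S x a \<longrightarrow> (x, x \<cdot>\<^bsub>S\<^esub> a) \<in> green_J S \<longrightarrow> (x, x \<cdot>\<^bsub>S\<^esub> a) \<in> green_R S) \<and>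
     (composable S a x \<longrightarrow> (x, a \<cdot>\<^bsub>S\<^esub> x) \<in> green_J S \<longrightarrow> (x, a \<cdot>\<^bsub>S\<^esub> x) \<in> green_L S))"

definition congruence_psg :: "('a, 'c, 'm) psg_scheme \<Rightarrow> ('a \<times> 'a) set \<Rightarrow> bool" where
  "congruence_psg S \<sigma> \<longleftrightarrow> equiv (elems S) \<sigma> \<and>
     (\<forall>(x, y)\<in>\<sigma>. dd S x = dd S y \<and> rr S x = rr S y \<and>
        (\<forall>a\<in>elems S.
           (composable S a x \<longrightarrow> (a \<cdot>\<^bsub>S\<^esub> x, a \<cdot>\<^bsub>S\<^esub> y) \<in> \<sigma>) \<and>
           (composable S x a \<longrightarrow> (x \<cdot>\<^bsub>S\<^esub> a, y \<cdot>\<^bsub>S\<^esub> a) \<in> \<sigma>)))"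

(* Meaningful when the pairs in \<Omega> are pairs of elements with equal dd and equal rr; for any
   other \<Omega> no congruence contains it and the intersection is UNIV. *)
definition cong_gen :: "('a, 'c, 'm) psg_scheme \<Rightarrow> ('a \<times> 'a) set \<Rightarrow> ('a \<times> 'a) set" where
  "cong_gen S \<Omega> = \<Inter> {\<sigma>. congruence_psg S \<sigma> \<and> \<Omega> \<subseteq> \<sigma>}"

definition Cong_H :: "('a, 'c, 'm) psg_scheme \<Rightarrow> ('a \<times> 'a) set set" where
  "Cong_H S = {\<sigma>. congruence_psg S \<sigma> \<and> \<sigma> \<subseteq> green_H S}"

definition H_group :: "('a, 'c, 'm) psg_scheme \<Rightarrow> 'a set \<Rightarrow> 'a monoid" where
  "H_group S G = \<lparr> carrier = G, monoid.mult = psg_mult S,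
     one = (THE e. e \<in> G \<and> (\<forall>x\<in>G. e \<cdot>\<^bsub>S\<^esub> x = x \<and> x \<cdot>\<^bsub>S\<^esub> e = x)) \<rparr>"

(* The middle conjunct says that all products in G are defined. *)
definition group_H_class :: "('a, 'c, 'm) psg_scheme \<Rightarrow> 'a set \<Rightarrow> bool" where
  "group_H_class S G \<longleftrightarrow> G \<in> elems S // green_H S \<and>
     (\<forall>x\<in>G. \<forall>y\<in>G. composable S x y) \<and> group (H_group S G)"

(* \<nu>_N for N inside a class D; the class is an explicit argument. *)
definition nu :: "('a, 'c, 'm) psg_scheme \<Rightarrow> 'a set \<Rightarrow> 'a set \<Rightarrow> ('a \<times> 'a) set" where
  "nu S D N = (let T = adjoin_ids S in
     {(u, v). u \<in> D \<and> v \<in> D \<and>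
        (\<exists>x\<in>N. \<exists>y\<in>N. \<exists>a\<in>elems T. \<exists>b\<in>elems T.
           composable T a (Inl x) \<and> composable T (Inl x) b \<and>
           composable T a (Inl y) \<and> composable T (Inl y) b \<and>
           Inl u = a \<cdot>\<^bsub>T\<^esub> Inl x \<cdot>\<^bsub>T\<^esub> b \<and> Inl v = a \<cdot>\<^bsub>T\<^esub> Inl y \<cdot>\<^bsub>T\<^esub> b)})"

definition zeta :: "('a, 'c, 'm) psg_scheme \<Rightarrow> ('a \<times> 'a) set" where
  "zeta S = (GREATEST \<sigma>. congruence_psg S \<sigma> \<and> \<sigma> \<subseteq> green_H S)"

definition Z_sub :: "('a, 'c, 'm) psg_scheme \<Rightarrow> 'a set \<Rightarrow> 'a set" where
  "Z_sub S G = {g \<in> G. (\<one>\<^bsub>H_group S G\<^esub>, g) \<in> zeta S}"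

(* For N normal in G_q: down S D_q N G_p is the subgroup of G_p obtained by pushing N down. *)
definition down :: "('a, 'c, 'm) psg_scheme \<Rightarrow> 'a set \<Rightarrow> 'a set \<Rightarrow> 'a set \<Rightarrow> 'a set" where
  "down S Dq N Gp = {g \<in> Gp. (\<one>\<^bsub>H_group S Gp\<^esub>, g) \<in> cong_gen S (nu S Dq N)}"

definition NZ_tuple ::
    "('a, 'c, 'm) psg_scheme \<Rightarrow> 'q set \<Rightarrow> ('q \<Rightarrow> 'a set) \<Rightarrow> ('q \<Rightarrow> 'a set) \<Rightarrow> ('q \<Rightarrow> 'a set) \<Rightarrow> bool"
  where
  "NZ_tuple S Q D G N \<longleftrightarrow>
     (\<forall>q\<in>Q. N q \<lhd> H_group S (G q) \<and> N q \<subseteq> Z_sub S (G q)) \<and>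
     (\<forall>p\<in>Q. \<forall>q\<in>Q. J_class_le S (D p) (D q) \<longrightarrow> down S (D q) (N q) (G p) \<subseteq> N p)"

definition Theta ::
    "('a, 'c, 'm) psg_scheme \<Rightarrow> 'q set \<Rightarrow> ('q \<Rightarrow> 'a set) \<Rightarrow> ('q \<Rightarrow> 'a set) \<Rightarrow> ('a \<times> 'a) set" where
  "Theta S Q D N = (\<Union>q\<in>Q. nu S (D q) (N q))"

(* Sanity of the encoding: S^1 is a category, J = D for stable S, and the largest congruence
   named by zeta exists. *)

lemma psgD:
  assumes "partial_semigroup S" "x \<in> elems S" "y \<in> elems S" "rr S x = dd S y"
  shows "x \<cdot>\<^bsub>S\<^esub> y \<in> elems S" "dd S (x \<cdot>\<^bsub>S\<^esub> y) = dd S x" "rr S (x \<cdot>\<^bsub>S\<^esub> y) = rr S y"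
  using assms by (auto simp: partial_semigroup_def composable_def)

lemma psg_assoc:
  assumes "partial_semigroup S" "x \<in> elems S" "y \<in> elems S" "z \<in> elems S"
    "rr S x = dd S y" "rr S y = dd S z"
  shows "(x \<cdot>\<^bsub>S\<^esub> y) \<cdot>\<^bsub>S\<^esub> z = x \<cdot>\<^bsub>S\<^esub> (y \<cdot>\<^bsub>S\<^esub> z)"
  using assms by (simp add: partial_semigroup_def composable_def)

lemma adjoin_ids_partial_semigroup:
  assumes "partial_semigroup S"
  shows "partial_semigroup (adjoin_ids S)"
  using assms
  by (auto simp: partial_semigroup_def adjoin_ids_def composable_def Pi_def)

lemma adjoin_ids_identity:
  assumes "c \<in> objs S"
  shows "\<exists>e. identity_at (adjoin_ids S) c e"
proof (cases "\<exists>e. identity_at S c e")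
  case True
  then obtain e where e: "identity_at S c e" by blast
  have "identity_at (adjoin_ids S) c (Inl e)"
    using e by (auto simp: identity_at_def adjoin_ids_def)
  then show ?thesis by blast
next
  case False
  have "x \<cdot>\<^bsub>adjoin_ids S\<^esub> Inr c = x" if "x \<in> elems (adjoin_ids S)" "rr (adjoin_ids S) x = c" for x
    using that by (cases x) (auto simp: adjoin_ids_def)
  then have "identity_at (adjoin_ids S) c (Inr c)"
    using False assms by (auto simp: identity_at_def[of "adjoin_ids S"]) (auto simp: adjoin_ids_def)
  then show ?thesis by blast
qed

context
  fixes S :: "('a, 'c, 'm) psg_scheme" and T
  assumes S: "partial_semigroup S"
  defines "T \<equiv> adjoin_ids S"
begin

lemma adj_psg: "partial_semigroup T" unfolding T_def by (rule adjoin_ids_partial_semigroup[OF S])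

lemma adj_Inl_in [simp]: "Inl x \<in> elems T \<longleftrightarrow> x \<in> elems S"
  and adj_Inl_mult [simp]: "Inl x \<cdot>\<^bsub>T\<^esub> Inl y = Inl (x \<cdot>\<^bsub>S\<^esub> y)"
  and adj_Inl_d [simp]: "dd T (Inl x) = dd S x" "rr T (Inl x) = rr S x"
  by (auto simp: T_def adjoin_ids_def)

lemma adj_identity:
  assumes "x \<in> elems T"
  shows "\<exists>e\<in>elems T. rr T e = dd T x \<and> e \<cdot>\<^bsub>T\<^esub> x = x" "\<exists>e\<in>elems T. rr T x = dd T e \<and> x \<cdot>\<^bsub>T\<^esub> e = x"
proof -
  have "dd T x \<in> objs S" "rr T x \<in> objs S"
    using adj_psg assms by (auto simp: partial_semigroup_def T_def adjoin_ids_def)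
  from adjoin_ids_identity[OF this(1)] adjoin_ids_identity[OF this(2)]
  show "\<exists>e\<in>elems T. rr T e = dd T x \<and> e \<cdot>\<^bsub>T\<^esub> x = x" "\<exists>e\<in>elems T. rr T x = dd T e \<and> x \<cdot>\<^bsub>T\<^esub> e = x"
    using assms unfolding T_def[symmetric] identity_at_def by metis+
qed

lemma two_sidedI:
  assumes "a \<in> elems T" "b \<in> elems T" "rr T a = dd S x" "rr S x = dd T b"
  shows "a \<cdot>\<^bsub>T\<^esub> Inl x \<cdot>\<^bsub>T\<^esub> b \<in> two_sided_ideal S x"
  using assms unfolding two_sided_ideal_def Let_def T_def[symmetric] composable_def
  by force

lemma two_sided_self: assumes "x \<in> elems S" shows "Inl x \<in> two_sided_ideal S x"
  using two_sidedI[of _ _ x] adj_identity[of "Inl x"] assms by (metis adj_Inl_in adj_Inl_d)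

lemma two_sided_mono:
  assumes y: "y \<in> elems S" and x: "Inl x \<in> two_sided_ideal S y"
  shows "two_sided_ideal S x \<subseteq> two_sided_ideal S y"
proof
  fix z assume "z \<in> two_sided_ideal S x"
  then obtain a b where ab: "a \<in> elems T" "b \<in> elems T" "rr T a = dd S x" "rr S x = dd T b"
    and z: "z = a \<cdot>\<^bsub>T\<^esub> Inl x \<cdot>\<^bsub>T\<^esub> b"
    unfolding two_sided_ideal_def Let_def T_def[symmetric] composable_def by auto
  from x obtain c d where cd: "c \<in> elems T" "d \<in> elems T" "rr T c = dd S y" "rr S y = dd T d"
    and xx: "Inl x = c \<cdot>\<^bsub>T\<^esub> Inl y \<cdot>\<^bsub>T\<^esub> d"
    unfolding two_sided_ideal_def Let_def T_def[symmetric] composable_def by auto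
  have dx: "dd S x = dd T c" "rr S x = rr T d"
    using arg_cong[OF xx, of "dd T"] arg_cong[OF xx, of "rr T"] cd y
    by (simp_all add: psgD[OF adj_psg])
  have "z = (a \<cdot>\<^bsub>T\<^esub> c) \<cdot>\<^bsub>T\<^esub> Inl y \<cdot>\<^bsub>T\<^esub> (d \<cdot>\<^bsub>T\<^esub> b)"
    using ab cd y dx unfolding z xx by (simp add: psgD[OF adj_psg] psg_assoc[OF adj_psg])
  then show "z \<in> two_sided_ideal S y"
    using two_sidedI[of "a \<cdot>\<^bsub>T\<^esub> c" "d \<cdot>\<^bsub>T\<^esub> b" y] ab cd y dx by (simp add: psgD[OF adj_psg])
qed

lemma green_J_iff: "(x, y) \<in> green_J S \<longleftrightarrow> x \<in> elems S \<and> y \<in> elems S \<and>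
   Inl x \<in> two_sided_ideal S y \<and> Inl y \<in> two_sided_ideal S x"
  unfolding green_J_def using two_sided_mono two_sided_self by blast

lemma right_two: "right_ideal S x \<subseteq> two_sided_ideal S x" if x: "x \<in> elems S"
proof
  fix z assume "z \<in> right_ideal S x"
  then obtain a where a: "a \<in> elems T" "rr S x = dd T a" "z = Inl x \<cdot>\<^bsub>T\<^esub> a"
    unfolding right_ideal_def Let_def T_def[symmetric] composable_def by auto
  obtain e where e: "e \<in> elems T" "rr T e = dd S x" "e \<cdot>\<^bsub>T\<^esub> Inl x = Inl x"
    using adj_identity[of "Inl x"] x by auto
  show "z \<in> two_sided_ideal S x" using two_sidedI[of e a x] a e by simp
qed

lemma left_two: "left_ideal S x \<subseteq> two_sided_ideal S x" if x: "x \<in> elems S"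
proof
  fix z assume "z \<in> left_ideal S x"
  then obtain a where a: "a \<in> elems T" "rr T a = dd S x" "z = a \<cdot>\<^bsub>T\<^esub> Inl x"
    unfolding left_ideal_def Let_def T_def[symmetric] composable_def by auto
  obtain e where e: "e \<in> elems T" "rr S x = dd T e" "Inl x \<cdot>\<^bsub>T\<^esub> e = Inl x"
    using adj_identity[of "Inl x"] x by auto
  show "z \<in> two_sided_ideal S x" using two_sidedI[of a e x] a e x by (simp add: psg_assoc[OF adj_psg])
qed

lemma right_self: assumes "x \<in> elems S" shows "Inl x \<in> right_ideal S x"
proof -
  obtain e where e: "e \<in> elems T" "rr S x = dd T e" "Inl x \<cdot>\<^bsub>T\<^esub> e = Inl x"
    using adj_identity[of "Inl x"] assms by auto
  then show ?thesis unfolding right_ideal_def Let_def T_def[symmetric] composable_def by force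
qed

lemma left_self: assumes "x \<in> elems S" shows "Inl x \<in> left_ideal S x"
proof -
  obtain e where e: "e \<in> elems T" "rr T e = dd S x" "e \<cdot>\<^bsub>T\<^esub> Inl x = Inl x"
    using adj_identity[of "Inl x"] assms by auto
  then show ?thesis unfolding left_ideal_def Let_def T_def[symmetric] composable_def by force
qed

lemma equiv_J: "equiv (elems S) (green_J S)"
  and equiv_R: "equiv (elems S) (green_R S)" and equiv_L: "equiv (elems S) (green_L S)"
  by (auto simp: equiv_def refl_on_def sym_def trans_def green_J_def green_R_def green_L_def)

lemma R_J: "green_R S \<subseteq> green_J S"
  using right_two right_self by (force simp: green_J_iff green_R_def)
lemma L_J: "green_L S \<subseteq> green_J S"
  using left_two left_self by (force simp: green_J_iff green_L_def)

lemma green_J_eq_D: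
  assumes st: "stable_psg S"
  shows "green_J S = green_D S"
proof
  show "green_D S \<subseteq> green_J S"
    unfolding green_D_def using equiv_J R_J L_J by blast
  have "(x, y) \<in> E" if xy: "(x, y) \<in> green_J S" and E: "equiv (elems S) E"
    and RE: "green_R S \<subseteq> E" and LE: "green_L S \<subseteq> E" for x y E
  proof -
    have x: "x \<in> elems S" and y: "y \<in> elems S"
      and "Inl y \<in> two_sided_ideal S x" using xy by (auto simp: green_J_iff)
    then obtain c d where cd: "c \<in> elems T" "d \<in> elems T" "rr T c = dd S x" "rr S x = dd T d"
      and yy: "Inl y = c \<cdot>\<^bsub>T\<^esub> Inl x \<cdot>\<^bsub>T\<^esub> d"
      unfolding two_sided_ideal_def Let_def T_def[symmetric] composable_def by auto
    obtain w where w: "c \<cdot>\<^bsub>T\<^esub> Inl x = Inl w"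
      by (cases c) (auto simp: T_def adjoin_ids_def)
    have wS: "w \<in> elems S" "rr S w = rr S x"
      using psgD[OF adj_psg cd(1) _ , of "Inl x"] w cd x by simp_all
    have wx: "Inl w \<in> two_sided_ideal S x"
      using left_two[OF x] cd w
      unfolding left_ideal_def Let_def T_def[symmetric] composable_def by force
    have yw: "Inl y \<in> two_sided_ideal S w"
      using right_two[OF wS(1)] cd wS yy w
      unfolding right_ideal_def Let_def T_def[symmetric] composable_def by force
    have J1: "(x, w) \<in> green_J S" and J2: "(w, y) \<in> green_J S"
      using wx yw x y wS xy two_sided_mono unfolding green_J_iff by blast+
    have "(x, w) \<in> green_L S"
    proof (cases c)
      case (Inl a)
      then show ?thesis using st J1 cd x w
        unfolding stable_psg_def composable_def by auto
    next
      case (Inr a)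
      then have "w = x" using w by (simp add: T_def adjoin_ids_def)
      then show ?thesis using x by (simp add: green_L_def)
    qed
    moreover have "(w, y) \<in> green_R S"
    proof (cases d)
      case (Inl a)
      then show ?thesis using st J2 cd wS w yy
        unfolding stable_psg_def composable_def by auto
    next
      case (Inr a)
      then have "w = y" using w yy by (simp add: T_def adjoin_ids_def)
      then show ?thesis using y by (simp add: green_R_def)
    qed
    ultimately show ?thesis using E RE LE unfolding equiv_def by (meson subsetD transD)
  qed
  then show "green_J S \<subseteq> green_D S" unfolding green_D_def by auto
qed

lemma zeta_exists: "\<exists>\<sigma>. (congruence_psg S \<sigma> \<and> \<sigma> \<subseteq> green_H S) \<and>
   (\<forall>\<tau>. congruence_psg S \<tau> \<and> \<tau> \<subseteq> green_H S \<longrightarrow> \<tau> \<subseteq> \<sigma>)"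
proof -
  define U where "U = \<Union> (Cong_H S)"
  have H: "equiv (elems S) (green_H S)"
    using equiv_R equiv_L unfolding green_H_def equiv_def refl_on_def sym_def trans_def by blast
  have UH: "U \<subseteq> green_H S" unfolding U_def Cong_H_def by auto
  have tr: "trans (green_H S)" using H by (simp add: equiv_def)
  have sub: "U\<^sup>+ \<subseteq> green_H S" using trancl_mono_subset[OF UH] tr by simp
  have US: "U \<subseteq> elems S \<times> elems S" using UH H by (auto simp: green_H_def green_R_def)
  have Ucomp: "dd S x = dd S y \<and> rr S x = rr S y \<and> (\<forall>a\<in>elems S.
           (composable S a x \<longrightarrow> (a \<cdot>\<^bsub>S\<^esub> x, a \<cdot>\<^bsub>S\<^esub> y) \<in> U) \<and>
           (composable S x a \<longrightarrow> (x \<cdot>\<^bsub>S\<^esub> a, y \<cdot>\<^bsub>S\<^esub> a) \<in> U))" if xyU: "(x, y) \<in> U" for x y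
  proof -
    obtain \<sigma> where \<sigma>: "congruence_psg S \<sigma>" "\<sigma> \<subseteq> U" "(x, y) \<in> \<sigma>"
      using xyU unfolding U_def Cong_H_def by blast
    show ?thesis using \<sigma>(1)[unfolded congruence_psg_def, THEN conjunct2, rule_format, OF \<sigma>(3)] \<sigma>(2)
      by auto
  qed
  have tc: "dd S x = dd S y \<and> rr S x = rr S y \<and> (\<forall>a\<in>elems S.
           (composable S a x \<longrightarrow> (a \<cdot>\<^bsub>S\<^esub> x, a \<cdot>\<^bsub>S\<^esub> y) \<in> U\<^sup>+) \<and>
           (composable S x a \<longrightarrow> (x \<cdot>\<^bsub>S\<^esub> a, y \<cdot>\<^bsub>S\<^esub> a) \<in> U\<^sup>+))" if "(x, y) \<in> U\<^sup>+" for x y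
    using that
  proof (induction rule: trancl_induct)
    case (base y)
    then show ?case using Ucomp[OF base] by (simp add: trancl.r_into_trancl)
  next
    case (step y z)
    have yz: "dd S y = dd S z" "rr S y = rr S z" using Ucomp[OF step(2)] by simp_all
    have xy: "dd S x = dd S y" "rr S x = rr S y" using step(3) by simp_all
    have "(a \<cdot>\<^bsub>S\<^esub> x, a \<cdot>\<^bsub>S\<^esub> z) \<in> U\<^sup>+" if "a \<in> elems S" "composable S a x" for a
    proof (rule trancl.trancl_into_trancl)
      show "(a \<cdot>\<^bsub>S\<^esub> x, a \<cdot>\<^bsub>S\<^esub> y) \<in> U\<^sup>+" using step(3) that by simp
      show "(a \<cdot>\<^bsub>S\<^esub> y, a \<cdot>\<^bsub>S\<^esub> z) \<in> U"
        using Ucomp[OF step(2)] that xy by (simp add: composable_def)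
    qed
    moreover have "(x \<cdot>\<^bsub>S\<^esub> a, z \<cdot>\<^bsub>S\<^esub> a) \<in> U\<^sup>+" if "a \<in> elems S" "composable S x a" for a
    proof (rule trancl.trancl_into_trancl)
      show "(x \<cdot>\<^bsub>S\<^esub> a, y \<cdot>\<^bsub>S\<^esub> a) \<in> U\<^sup>+" using step(3) that by simp
      show "(y \<cdot>\<^bsub>S\<^esub> a, z \<cdot>\<^bsub>S\<^esub> a) \<in> U"
        using Ucomp[OF step(2)] that xy by (simp add: composable_def)
    qed
    ultimately show ?case using xy yz by simp
  qed
  have tc': "\<forall>(x, y)\<in>U\<^sup>+. dd S x = dd S y \<and> rr S x = rr S y \<and> (\<forall>a\<in>elems S.
           (composable S a x \<longrightarrow> (a \<cdot>\<^bsub>S\<^esub> x, a \<cdot>\<^bsub>S\<^esub> y) \<in> U\<^sup>+) \<and>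
           (composable S x a \<longrightarrow> (x \<cdot>\<^bsub>S\<^esub> a, y \<cdot>\<^bsub>S\<^esub> a) \<in> U\<^sup>+))"
    by (rule ballI, rule case_prodI2, rule tc) simp
  have "sym \<sigma>" if "\<sigma> \<in> Cong_H S" for \<sigma>
    using that by (auto simp: Cong_H_def congruence_psg_def equiv_def)
  then have "sym U" unfolding U_def sym_def by blast
  moreover have "Id_on (elems S) \<in> Cong_H S"
  proof -
    have e: "equiv (elems S) (Id_on (elems S))" by (auto simp: equiv_def refl_on_def sym_def trans_def)
    have "Id_on (elems S) \<subseteq> green_H S" by (auto simp: green_H_def green_R_def green_L_def)
    then show ?thesis using e S
      unfolding Cong_H_def congruence_psg_def partial_semigroup_def composable_def by auto
  qed
  then have id: "Id_on (elems S) \<subseteq> U" unfolding U_def by (rule Union_upper)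
  have "refl_on (elems S) (U\<^sup>+)"
    by (rule refl_onI) (use id in \<open>auto intro: r_into_trancl\<close>)
  ultimately have "equiv (elems S) (U\<^sup>+)"
    using trancl_subset_Sigma[OF US] by (intro equivI sym_trancl trans_trancl)
  then have "congruence_psg S (U\<^sup>+)" unfolding congruence_psg_def
    by (rule conjI[OF _ tc'])
  moreover have "\<tau> \<subseteq> U\<^sup>+" if "congruence_psg S \<tau> \<and> \<tau> \<subseteq> green_H S" for \<tau>
  proof -
    have "\<tau> \<subseteq> U" using that unfolding U_def Cong_H_def by blast
    then show ?thesis by (auto intro: r_into_trancl)
  qed
  ultimately show ?thesis using sub by (intro exI[of _ "U\<^sup>+"]) simp
qed

declare adj_Inl_in [simp del] adj_Inl_mult [simp del] adj_Inl_d [simp del]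

end

end

theory Submission
  imports Defs
begin

text \<open>The central fact is that a congruence contained in \<open>\<H>\<close> is determined on each \<open>\<D>\<close>-class by its
  restriction to the class of the identity of one group \<open>\<H>\<close>-class: by stability, an element of the
  \<open>\<D>\<close>-class has the form \<open>a e b\<close>, where multiplication by \<open>a\<close> and \<open>b\<close> is undone on its whole
  \<open>\<H>\<close>-class by some \<open>a'\<close> and \<open>b'\<close>. Applied to the congruence generated by \<open>\<nu>\<close> of a member \<open>N\<^sub>q\<close> of
  an NZ-tuple, this fact describes that congruence on every lower class, and the inclusions of the
  pushed-down subgroups in \<open>N\<^sub>p\<close> (for \<open>p = q\<close> too) give transitivity and compatibility of the union.\<close>

section \<open>Congruences: intersections, generation, and the largest one inside
  \<open>green_H\<close>\<close>

lemma congruence_psgD: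
  assumes "congruence_psg S \<sigma>" "(x, y) \<in> \<sigma>"
  shows "x \<in> elems S" "y \<in> elems S" "dd S x = dd S y" "rr S x = rr S y"
    and "\<And>a. a \<in> elems S \<Longrightarrow> rr S a = dd S x \<Longrightarrow> (a \<cdot>\<^bsub>S\<^esub> x, a \<cdot>\<^bsub>S\<^esub> y) \<in> \<sigma>"
    and "\<And>a. a \<in> elems S \<Longrightarrow> rr S x = dd S a \<Longrightarrow> (x \<cdot>\<^bsub>S\<^esub> a, y \<cdot>\<^bsub>S\<^esub> a) \<in> \<sigma>"
  using assms by (auto simp: congruence_psg_def composable_def equiv_def refl_on_def)

lemma congruence_psg_refl: "congruence_psg S \<sigma> \<Longrightarrow> x \<in> elems S \<Longrightarrow> (x, x) \<in> \<sigma>"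
  by (simp add: congruence_psg_def equiv_def refl_on_def)

lemma congruence_psg_sym: "congruence_psg S \<sigma> \<Longrightarrow> (x, y) \<in> \<sigma> \<Longrightarrow> (y, x) \<in> \<sigma>"
  by (auto simp: congruence_psg_def equiv_def dest: symD)

lemma congruence_psg_trans:
  "congruence_psg S \<sigma> \<Longrightarrow> (x, y) \<in> \<sigma> \<Longrightarrow> (y, z) \<in> \<sigma> \<Longrightarrow> (x, z) \<in> \<sigma>"
  by (auto simp: congruence_psg_def equiv_def dest: transD)

text \<open>The intersection of the empty family is \<open>UNIV\<close>; a member of
  \<open>C\<close> is what confines the pairs to \<open>elems S\<close> and supplies the conditions
  on \<open>dd\<close> and \<open>rr\<close>.\<close>

lemma congruence_psg_Inter:
  assumes "C \<noteq> {}" "\<And>\<sigma>. \<sigma> \<in> C \<Longrightarrow> congruence_psg S \<sigma>"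
  shows "congruence_psg S (\<Inter>C)"
proof -
  obtain \<tau> where \<tau>: "\<tau> \<in> C" using assms(1) by blast
  have "\<Inter>C \<subseteq> elems S \<times> elems S"
    using \<tau> congruence_psgD(1,2)[OF assms(2)[OF \<tau>]] by auto
  then have "equiv (elems S) (\<Inter>C)"
    using assms(2)
    by (intro equivI refl_onI symI transI)
      (blast intro: congruence_psg_refl congruence_psg_sym congruence_psg_trans)+
  moreover have "dd S x = dd S y" "rr S x = rr S y" if "(x, y) \<in> \<Inter>C" for x y
    using that \<tau> congruence_psgD(3,4)[OF assms(2)[OF \<tau>]] by auto
  ultimately show ?thesis
    using assms(2) unfolding congruence_psg_def[of S "\<Inter>C"] composable_def
    by (auto intro: congruence_psgD(5,6))
qed

lemma cong_gen_least: "congruence_psg S \<sigma> \<Longrightarrow> \<Omega> \<subseteq> \<sigma> \<Longrightarrow> cong_gen S \<Omega> \<subseteq> \<sigma>"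
  unfolding cong_gen_def by blast

lemma cong_gen_incl: "\<Omega> \<subseteq> cong_gen S \<Omega>"
  unfolding cong_gen_def by blast

text \<open>The given \<open>\<sigma>\<close> makes the intersected family nonempty. For an
  NZ-tuple, \<open>zeta S\<close> will take this role.\<close>

lemma cong_gen_congruence:
  "congruence_psg S \<sigma> \<Longrightarrow> \<Omega> \<subseteq> \<sigma> \<Longrightarrow> congruence_psg S (cong_gen S \<Omega>)"
  unfolding cong_gen_def by (rule congruence_psg_Inter) auto

text \<open>\<open>GREATEST\<close> is a description, so it yields these properties only once a
  greatest congruence is known to exist; \<open>zeta_exists\<close> provides one.\<close>

lemma zeta_greatest:
  assumes "partial_semigroup S"
  shows "congruence_psg S (zeta S)" "zeta S \<subseteq> green_H S"
    and "\<And>\<sigma>. congruence_psg S \<sigma> \<Longrightarrow> \<sigma> \<subseteq> green_H S \<Longrightarrow> \<sigma> \<subseteq> zeta S"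
proof -
  obtain \<zeta> where \<zeta>: "congruence_psg S \<zeta> \<and> \<zeta> \<subseteq> green_H S"
    "\<forall>\<tau>. congruence_psg S \<tau> \<and> \<tau> \<subseteq> green_H S \<longrightarrow> \<tau> \<subseteq> \<zeta>"
    using zeta_exists[OF assms] by blast
  then have "zeta S = \<zeta>"
    unfolding zeta_def by (intro Greatest_equality) auto
  then show "congruence_psg S (zeta S)" "zeta S \<subseteq> green_H S"
    "\<And>\<sigma>. congruence_psg S \<sigma> \<Longrightarrow> \<sigma> \<subseteq> green_H S \<Longrightarrow> \<sigma> \<subseteq> zeta S"
    using \<zeta> by auto
qed

section \<open>Green's relations and principal ideals expressed by products in
  \<open>S\<close>\<close>

text \<open>The multiplier comes from the category with adjoined identities. If it is an adjoined
  identity, the two elements coincide; otherwise it lies in \<open>S\<close>.\<close>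

lemma green_R_cases:
  assumes "partial_semigroup S" "(x, y) \<in> green_R S"
  obtains "y = x" | c where "c \<in> elems S" "rr S x = dd S c" "y = x \<cdot>\<^bsub>S\<^esub> c"
proof -
  have "Inl y \<in> right_ideal S x"
    using assms right_self[OF assms(1), of y] by (auto simp: green_R_def)
  then obtain c where "c \<in> elems (adjoin_ids S)" "composable (adjoin_ids S) (Inl x) c"
    "Inl y = Inl x \<cdot>\<^bsub>adjoin_ids S\<^esub> c"
    unfolding right_ideal_def Let_def by blast
  then show thesis
    using that by (cases c) (auto simp: adjoin_ids_def composable_def)
qed

lemma green_L_cases:
  assumes "partial_semigroup S" "(x, y) \<in> green_L S"
  obtains "y = x" | c where "c \<in> elems S" "rr S c = dd S x" "y = c \<cdot>\<^bsub>S\<^esub> x"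
proof -
  have "Inl y \<in> left_ideal S x"
    using assms left_self[OF assms(1), of y] by (auto simp: green_L_def)
  then obtain c where "c \<in> elems (adjoin_ids S)" "composable (adjoin_ids S) c (Inl x)"
    "Inl y = c \<cdot>\<^bsub>adjoin_ids S\<^esub> Inl x"
    unfolding left_ideal_def Let_def by blast
  then show thesis
    using that by (cases c) (auto simp: adjoin_ids_def composable_def)
qed

lemma two_sided_mult:
  assumes S: "partial_semigroup S" and xa: "x \<in> elems S" "a \<in> elems S"
  shows "rr S x = dd S a \<Longrightarrow> Inl (x \<cdot>\<^bsub>S\<^esub> a) \<in> two_sided_ideal S x"
    and "rr S a = dd S x \<Longrightarrow> Inl (a \<cdot>\<^bsub>S\<^esub> x) \<in> two_sided_ideal S x"
proof -
  assume "rr S x = dd S a"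
  then have "Inl (x \<cdot>\<^bsub>S\<^esub> a) \<in> right_ideal S x"
    unfolding right_ideal_def Let_def using xa
    by (intro CollectI exI[of _ "Inl a"]) (simp add: adjoin_ids_def composable_def)
  then show "Inl (x \<cdot>\<^bsub>S\<^esub> a) \<in> two_sided_ideal S x"
    using right_two[OF S xa(1)] by blast
next
  assume "rr S a = dd S x"
  then have "Inl (a \<cdot>\<^bsub>S\<^esub> x) \<in> left_ideal S x"
    unfolding left_ideal_def Let_def using xa
    by (intro CollectI exI[of _ "Inl a"]) (simp add: adjoin_ids_def composable_def)
  then show "Inl (a \<cdot>\<^bsub>S\<^esub> x) \<in> two_sided_ideal S x"
    using left_two[OF S xa(1)] by blast
qed

text \<open>An idempotent \<open>e\<close> can itself replace an adjoined identity on either side,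
  so both factors can be taken in \<open>S\<close> and no case distinction remains.\<close>

lemma two_sided_idempotent:
  assumes S: "partial_semigroup S" and e: "e \<in> elems S" "rr S e = dd S e" "e \<cdot>\<^bsub>S\<^esub> e = e"
    and u: "Inl u \<in> two_sided_ideal S e"
  obtains a b where "a \<in> elems S" "b \<in> elems S" "rr S a = dd S e" "rr S e = dd S b"
    "u = a \<cdot>\<^bsub>S\<^esub> e \<cdot>\<^bsub>S\<^esub> b"
proof -
  obtain a b where ab: "a \<in> elems (adjoin_ids S)" "b \<in> elems (adjoin_ids S)"
    "composable (adjoin_ids S) a (Inl e)" "composable (adjoin_ids S) (Inl e) b"
    "Inl u = a \<cdot>\<^bsub>adjoin_ids S\<^esub> Inl e \<cdot>\<^bsub>adjoin_ids S\<^esub> b"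
    using u unfolding two_sided_ideal_def Let_def by blast
  \<comment> \<open>Needed when the right factor is an adjoined identity and \<open>e\<close> is put
    in its place.\<close>
  have ae: "a' \<cdot>\<^bsub>S\<^esub> e \<cdot>\<^bsub>S\<^esub> e = a' \<cdot>\<^bsub>S\<^esub> e" if "a' \<in> elems S" "rr S a' = dd S e" for a'
    using psg_assoc[OF S that(1) e(1) e(1)] that e by simp
  define a' where "a' = (case a of Inl s \<Rightarrow> s | Inr _ \<Rightarrow> e)"
  define b' where "b' = (case b of Inl s \<Rightarrow> s | Inr _ \<Rightarrow> e)"
  have "a' \<in> elems S" "b' \<in> elems S" "rr S a' = dd S e" "rr S e = dd S b'"
    "u = a' \<cdot>\<^bsub>S\<^esub> e \<cdot>\<^bsub>S\<^esub> b'"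
    using ab e ae unfolding a'_def b'_def
    by (cases a; cases b; auto simp: adjoin_ids_def composable_def)+
  then show thesis using that by blast
qed

section \<open>Group H-classes and the relations \<open>nu\<close>\<close>

text \<open>Translates the group axioms into products of \<open>S\<close>. The identity
  \<open>e\<close> becomes an idempotent of \<open>S\<close>, the base point for the stability
  argument.\<close>

lemma group_H_classD:
  assumes S: "partial_semigroup S" and G: "group_H_class S G"
  defines "e \<equiv> \<one>\<^bsub>H_group S G\<^esub>"
  shows "e \<in> G" "e \<in> elems S" "rr S e = dd S e" "e \<cdot>\<^bsub>S\<^esub> e = e"
    and "G = green_H S `` {e}"
    and "\<And>x. x \<in> G \<Longrightarrow> x \<in> elems S \<and> dd S x = dd S e \<and> rr S x = dd S e \<and>
           e \<cdot>\<^bsub>S\<^esub> x = x \<and> x \<cdot>\<^bsub>S\<^esub> e = x"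
proof -
  interpret group "H_group S G" using G by (simp add: group_H_class_def)
  have H: "equiv (elems S) (green_H S)"
    using equiv_R[OF S] equiv_L[OF S]
    unfolding green_H_def equiv_def refl_on_def sym_def trans_def by blast
  have cl: "G \<in> elems S // green_H S" and comp: "\<forall>x\<in>G. \<forall>y\<in>G. composable S x y"
    using G by (auto simp: group_H_class_def)
  show eG: "e \<in> G" unfolding e_def using one_closed by (simp add: H_group_def)
  show GS: "x \<in> elems S \<and> dd S x = dd S e \<and> rr S x = dd S e \<and> e \<cdot>\<^bsub>S\<^esub> x = x \<and> x \<cdot>\<^bsub>S\<^esub> e = x"
    if "x \<in> G" for x
  proof -
    have "x \<in> elems S" using that in_quotient_imp_subset[OF H cl] by blast
    moreover have "rr S x = dd S e" "rr S x = dd S x"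
      using comp that eG unfolding composable_def by blast+
    moreover have "e \<cdot>\<^bsub>S\<^esub> x = x" "x \<cdot>\<^bsub>S\<^esub> e = x"
      using l_one[of x] r_one[of x] that unfolding e_def by (simp_all add: H_group_def)
    ultimately show ?thesis by simp
  qed
  show "e \<in> elems S" "rr S e = dd S e" "e \<cdot>\<^bsub>S\<^esub> e = e" using GS[OF eG] by auto
  show "G = green_H S `` {e}"
    using cl eG H by (metis Image_singleton_iff equiv_class_eq_iff quotientE)
qed

text \<open>Each pair of \<open>nu\<close> arises from a related pair by a left and a right
  multiplication, and multiplying by an adjoined identity changes nothing.\<close>

lemma nu_subset_congruence:
  assumes S: "partial_semigroup S" and \<sigma>: "congruence_psg S \<sigma>"
    and N: "\<And>x y. x \<in> N \<Longrightarrow> y \<in> N \<Longrightarrow> (x, y) \<in> \<sigma>"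
  shows "nu S D N \<subseteq> \<sigma>"
proof (rule subrelI)
  fix u v assume "(u, v) \<in> nu S D N"
  then obtain x y a b where xy: "x \<in> N" "y \<in> N"
    and ab: "a \<in> elems (adjoin_ids S)" "b \<in> elems (adjoin_ids S)"
    "composable (adjoin_ids S) a (Inl x)" "composable (adjoin_ids S) (Inl x) b"
    and u: "Inl u = a \<cdot>\<^bsub>adjoin_ids S\<^esub> Inl x \<cdot>\<^bsub>adjoin_ids S\<^esub> b"
    and v: "Inl v = a \<cdot>\<^bsub>adjoin_ids S\<^esub> Inl y \<cdot>\<^bsub>adjoin_ids S\<^esub> b"
    unfolding nu_def Let_def by blast
  have xy\<sigma>: "(x, y) \<in> \<sigma>" using N xy by blast
  \<comment> \<open>\<open>u'\<close> and \<open>v'\<close> are the products of \<open>x\<close> and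
    \<open>y\<close> with the left factor \<open>a\<close> alone, read inside
    \<open>S\<close>.\<close>
  define u' where "u' = (case a of Inl s \<Rightarrow> s \<cdot>\<^bsub>S\<^esub> x | Inr _ \<Rightarrow> x)"
  define v' where "v' = (case a of Inl s \<Rightarrow> s \<cdot>\<^bsub>S\<^esub> y | Inr _ \<Rightarrow> y)"
  have u'v': "(u', v') \<in> \<sigma>"
    using ab xy\<sigma> congruence_psgD(5)[OF \<sigma> xy\<sigma>] unfolding u'_def v'_def
    by (cases a) (auto simp: adjoin_ids_def composable_def)
  have "rr S u' = rr S x"
    using ab psgD(3)[OF S _ congruence_psgD(1)[OF \<sigma> xy\<sigma>]] unfolding u'_def
    by (cases a) (auto simp: adjoin_ids_def composable_def)
  then show "(u, v) \<in> \<sigma>"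
    using ab u v u'v' congruence_psgD(6)[OF \<sigma> u'v'] unfolding u'_def v'_def
    by (cases a; cases b) (auto simp: adjoin_ids_def composable_def)
qed

lemma nuI:
  assumes "partial_semigroup S" "u \<in> D" "v \<in> D" "x \<in> N" "y \<in> N" "a \<in> elems S" "b \<in> elems S"
    "rr S a = dd S x" "rr S x = dd S b" "rr S a = dd S y" "rr S y = dd S b"
    "u = a \<cdot>\<^bsub>S\<^esub> x \<cdot>\<^bsub>S\<^esub> b" "v = a \<cdot>\<^bsub>S\<^esub> y \<cdot>\<^bsub>S\<^esub> b"
  shows "(u, v) \<in> nu S D N"
  unfolding nu_def Let_def using assms
  by (intro CollectI case_prodI conjI bexI[of _ x] bexI[of _ y] bexI[of _ "Inl a"] bexI[of _ "Inl b"])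
    (auto simp: adjoin_ids_def composable_def)

section \<open>Stability, and recovering a congruence from one group H-class\<close>

text \<open>With \<open>u = a e b\<close> and \<open>w = a e\<close>, stability makes
  \<open>w\<close> L-related to \<open>e\<close> and R-related to \<open>u\<close>. This gives
  \<open>a' w = e\<close> and \<open>u b' = w\<close>, hence the four product identities. The
  equations for \<open>dd\<close> and \<open>rr\<close> are recorded because every later product
  must be shown to be defined.\<close>

lemma stable_local_inverses:
  assumes S: "partial_semigroup S" and st: "stable_psg S"
    and e: "e \<in> elems S" "rr S e = dd S e" "e \<cdot>\<^bsub>S\<^esub> e = e" and J: "(e, u) \<in> green_J S"
  obtains a b a' b' where
    "a \<in> elems S" "b \<in> elems S" "a' \<in> elems S" "b' \<in> elems S"
    "rr S a = dd S e" "dd S b = dd S e" "rr S a' = dd S a" "dd S b' = rr S b"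
    "dd S a = dd S u" "rr S b = rr S u" "dd S a' = dd S e" "rr S b' = dd S e"
    "u = a \<cdot>\<^bsub>S\<^esub> e \<cdot>\<^bsub>S\<^esub> b" "a' \<cdot>\<^bsub>S\<^esub> u \<cdot>\<^bsub>S\<^esub> b' = e"
    "a \<cdot>\<^bsub>S\<^esub> (a' \<cdot>\<^bsub>S\<^esub> u) = u" "u \<cdot>\<^bsub>S\<^esub> b' \<cdot>\<^bsub>S\<^esub> b = u"
proof -
  have uS: "u \<in> elems S" and ue: "Inl u \<in> two_sided_ideal S e"
    and eu: "Inl e \<in> two_sided_ideal S u" using J by (auto simp: green_J_iff[OF S])
  obtain a b where a: "a \<in> elems S" "rr S a = dd S e" and b: "b \<in> elems S" "rr S e = dd S b"
    and u: "u = a \<cdot>\<^bsub>S\<^esub> e \<cdot>\<^bsub>S\<^esub> b"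
    using two_sided_idempotent[OF S e ue] by metis
  define w where "w = a \<cdot>\<^bsub>S\<^esub> e"
  have w: "w \<in> elems S" "dd S w = dd S a" "rr S w = dd S e"
    using psgD[OF S a(1) e(1) a(2)] e unfolding w_def by simp_all
  have wee: "w \<cdot>\<^bsub>S\<^esub> e = w"
    using psg_assoc[OF S a(1) e(1) e(1) a(2) e(2)] e unfolding w_def by simp
  have uwb: "u = w \<cdot>\<^bsub>S\<^esub> b" using u w_def by simp
  have ud: "dd S u = dd S a" "rr S u = rr S b"
    using psgD[OF S w(1) b(1)] w b e unfolding uwb by simp_all
  have uw: "Inl u \<in> two_sided_ideal S w"
    using two_sided_mult(1)[OF S w(1) b(1)] w b e unfolding uwb by simp
  have we: "Inl w \<in> two_sided_ideal S e"
    using two_sided_mult(2)[OF S e(1) a(1) a(2)] unfolding w_def .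
  \<comment> \<open>The ideals of \<open>e\<close>, \<open>u\<close> and \<open>w\<close> contain
    each other cyclically: \<open>e\<close> lies in that of \<open>u\<close>, \<open>u\<close> in
    that of \<open>w\<close>, and \<open>w\<close> in that of \<open>e\<close>.\<close>
  have "(e, w) \<in> green_J S"
    using uw we eu two_sided_mono[OF S w(1) uw] e w by (auto simp: green_J_iff[OF S])
  then have "(w, e) \<in> green_L S"
    using st e(1) a equiv_L[OF S] unfolding stable_psg_def composable_def w_def equiv_def sym_def
    by blast
  then obtain a' where a': "a' \<in> elems S" "rr S a' = dd S a" "dd S a' = dd S e" "a' \<cdot>\<^bsub>S\<^esub> w = e"
  proof (cases rule: green_L_cases[OF S, consumes 1])
    \<comment> \<open>Here \<open>w = e\<close>, and the idempotent \<open>e\<close> serves as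
      \<open>a'\<close>.\<close>
    case 1
    with e w(2) show thesis by (intro that[of e]) (simp_all only:)
  next
    case (2 c)
    then have "dd S c = dd S e" using psgD(2)[OF S 2(1) w(1)] by simp
    with 2 w(2) show thesis by (intro that[of c]) (simp_all only:)
  qed
  have "(w, u) \<in> green_J S"
    using uw we eu two_sided_mono[OF S uS eu] uS w by (auto simp: green_J_iff[OF S])
  then have "(w, u) \<in> green_R S"
    using st w b e unfolding stable_psg_def composable_def uwb by simp
  then have "(u, w) \<in> green_R S" using equiv_R[OF S] unfolding equiv_def sym_def by blast
  then obtain b' where b': "b' \<in> elems S" "dd S b' = rr S b" "rr S b' = dd S e" "u \<cdot>\<^bsub>S\<^esub> b' = w"
  proof (cases rule: green_R_cases[OF S, consumes 1])
    \<comment> \<open>Here \<open>w = u\<close>, and \<open>e\<close> serves as \<open>b'\<close>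
      because \<open>w e = w\<close>.\<close>
    case 1
    with e(1,2) w(3) wee ud(2) show thesis by (intro that[of e]) (simp_all only:)
  next
    case (2 c)
    then have "rr S c = dd S e" using psgD(3)[OF S uS 2(1)] w(3) by simp
    with 2 ud(2) show thesis by (intro that[of c]) (simp_all only:)
  qed
  have "a' \<cdot>\<^bsub>S\<^esub> u \<cdot>\<^bsub>S\<^esub> b' = e"
    using psg_assoc[OF S a'(1) uS b'(1)] a' b' ud by simp
  moreover have a'u: "a' \<cdot>\<^bsub>S\<^esub> u = e \<cdot>\<^bsub>S\<^esub> b"
    using psg_assoc[OF S a'(1) w(1) b(1)] a' w b e unfolding uwb by simp
  moreover have "a \<cdot>\<^bsub>S\<^esub> (a' \<cdot>\<^bsub>S\<^esub> u) = u"
    using psg_assoc[OF S a(1) e(1) b(1) a(2) b(2)] u a'u by simp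
  moreover have "u \<cdot>\<^bsub>S\<^esub> b' \<cdot>\<^bsub>S\<^esub> b = u" using b' uwb by simp
  ultimately show thesis
    using that[of a b a' b'] a b a' b' e u ud by simp
qed

text \<open>Multiplying \<open>u\<close> and \<open>v\<close> by \<open>a'\<close> and
  \<open>b'\<close> turns the pair into \<open>(e, y)\<close> with \<open>y = a' v b'\<close>. Since
  \<open>\<sigma>\<close> lies inside \<open>green_H\<close>, \<open>y\<close> belongs to
  \<open>G\<close>. Multiplying by \<open>a\<close> and \<open>b\<close> gives back
  \<open>u = a e b\<close> and \<open>v = a y b\<close>, a pair of \<open>nu\<close>.\<close>

lemma congruence_in_nu:
  assumes S: "partial_semigroup S" and st: "stable_psg S" and G: "group_H_class S G"
    and D: "D \<in> elems S // green_J S" "G \<subseteq> D"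
    and \<sigma>: "congruence_psg S \<sigma>" "\<sigma> \<subseteq> green_H S" and uv: "(u, v) \<in> \<sigma>" "u \<in> D"
  shows "(u, v) \<in> nu S D {g \<in> G. (\<one>\<^bsub>H_group S G\<^esub>, g) \<in> \<sigma>}"
proof -
  define e where "e = \<one>\<^bsub>H_group S G\<^esub>"
  note e = group_H_classD[OF S G, folded e_def]
  have inJ: "(x, y) \<in> green_J S \<longleftrightarrow> y \<in> D" if "x \<in> D" for x y
  proof -
    have "D = green_J S `` {x}"
      using D(1) that equiv_J[OF S] by (metis Image_singleton_iff equiv_class_eq_iff quotientE)
    then show ?thesis by blast
  qed
  have uvH: "(u, v) \<in> green_R S" "(u, v) \<in> green_L S"
    using \<sigma>(2) uv(1) by (auto simp: green_H_def)
  have vD: "v \<in> D" using uvH(1) R_J[OF S] inJ[OF uv(2)] by blast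
  note uvS = congruence_psgD(1-4)[OF \<sigma>(1) uv(1)]
  have "e \<in> D" using e(1) D(2) by blast
  then obtain a b a' b' where
    ab: "a \<in> elems S" "b \<in> elems S" "a' \<in> elems S" "b' \<in> elems S"
    "rr S a = dd S e" "dd S b = dd S e" "rr S a' = dd S a" "dd S b' = rr S b"
    "dd S a = dd S u" "rr S b = rr S u" "dd S a' = dd S e" "rr S b' = dd S e"
    and u: "u = a \<cdot>\<^bsub>S\<^esub> e \<cdot>\<^bsub>S\<^esub> b" "a' \<cdot>\<^bsub>S\<^esub> u \<cdot>\<^bsub>S\<^esub> b' = e"
    "a \<cdot>\<^bsub>S\<^esub> (a' \<cdot>\<^bsub>S\<^esub> u) = u" "u \<cdot>\<^bsub>S\<^esub> b' \<cdot>\<^bsub>S\<^esub> b = u"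
    using inJ[of e u] uv(2) by (auto elim: stable_local_inverses[OF S st e(2-4)])
  \<comment> \<open>Since \<open>v\<close> is \<open>u\<close> or some \<open>u c\<close>, left
    multiplication by \<open>a'\<close> and then \<open>a\<close> fixes \<open>v\<close> as it fixes
    \<open>u\<close>.\<close>
  have v1: "a \<cdot>\<^bsub>S\<^esub> (a' \<cdot>\<^bsub>S\<^esub> v) = v"
    using uvH(1)
  proof (cases rule: green_R_cases[OF S, consumes 1])
    case 1
    then show ?thesis using u by simp
  next
    case (2 c)
    then show ?thesis
      using u(3) ab uvS psgD[OF S ab(3) uvS(1)] by (metis psg_assoc[OF S])
  qed
  \<comment> \<open>Dually, \<open>v\<close> is \<open>u\<close> or some \<open>c u\<close>, so the
    identity for \<open>u\<close> on the right passes to \<open>v\<close>.\<close>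
  have v2: "v \<cdot>\<^bsub>S\<^esub> b' \<cdot>\<^bsub>S\<^esub> b = v"
    using uvH(2)
  proof (cases rule: green_L_cases[OF S, consumes 1])
    case 1
    then show ?thesis using u by simp
  next
    case (2 c)
    then show ?thesis
      using u(4) ab uvS psgD[OF S uvS(1) ab(4)] psgD[OF S ab(4) ab(2)] by (metis psg_assoc[OF S])
  qed
  define y where "y = a' \<cdot>\<^bsub>S\<^esub> v \<cdot>\<^bsub>S\<^esub> b'"
  have a'v: "a' \<cdot>\<^bsub>S\<^esub> v \<in> elems S" "dd S (a' \<cdot>\<^bsub>S\<^esub> v) = dd S e" "rr S (a' \<cdot>\<^bsub>S\<^esub> v) = rr S u"
    using psgD[OF S ab(3) uvS(2)] ab uvS by simp_all
  have a'u: "rr S (a' \<cdot>\<^bsub>S\<^esub> u) = rr S u"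
    using psgD[OF S ab(3) uvS(1)] ab uvS by simp
  have "(a' \<cdot>\<^bsub>S\<^esub> u, a' \<cdot>\<^bsub>S\<^esub> v) \<in> \<sigma>"
    using congruence_psgD(5)[OF \<sigma>(1) uv(1) ab(3)] ab by simp
  then have ey: "(e, y) \<in> \<sigma>"
    using congruence_psgD(6)[OF \<sigma>(1) _ ab(4)] ab u(2) a'u unfolding y_def by metis
  then have yG: "y \<in> G" using e(5) \<sigma>(2) by blast
  have yb: "y \<cdot>\<^bsub>S\<^esub> b = a' \<cdot>\<^bsub>S\<^esub> v"
    unfolding y_def using v2 psg_assoc[OF S a'v(1) ab(4,2)] psg_assoc[OF S ab(3) uvS(2)]
      psgD[OF S ab(4,2)] a'v ab uvS by (metis psg_assoc[OF S])
  have "a \<cdot>\<^bsub>S\<^esub> y \<cdot>\<^bsub>S\<^esub> b = v"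
    using psg_assoc[OF S ab(1) _ ab(2), of y] e(6)[OF yG] ab v1 yb by simp
  then have "(u, v) \<in> nu S D {g \<in> G. (e, g) \<in> \<sigma>}"
    using nuI[OF S uv(2) vD, of e _ y a b] e(1,2,3) e(6)[OF yG] ab u(1) ey yG
      congruence_psg_refl[OF \<sigma>(1) e(2)] by simp
  then show ?thesis unfolding e_def .
qed

section \<open>Normal subgroups cut out by congruences\<close>

text \<open>A congruence on \<open>S\<close> restricts to a congruence of the group, and the class
  of the identity under a group congruence is a normal subgroup.\<close>

lemma congruence_class_normal:
  assumes S: "partial_semigroup S" and G: "group_H_class S G" and \<sigma>: "congruence_psg S \<sigma>"
  shows "{g \<in> G. (\<one>\<^bsub>H_group S G\<^esub>, g) \<in> \<sigma>} \<lhd> H_group S G" (is "?N \<lhd> _")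
proof -
  interpret group "H_group S G" using G by (simp add: group_H_class_def)
  let ?H = "H_group S G"
  have car: "carrier ?H = G" and mul: "\<And>x y. x \<otimes>\<^bsub>?H\<^esub> y = x \<cdot>\<^bsub>S\<^esub> y"
    by (simp_all add: H_group_def)
  note e = group_H_classD[OF S G]
  have left: "(z \<otimes>\<^bsub>?H\<^esub> x, z \<otimes>\<^bsub>?H\<^esub> y) \<in> \<sigma>" if "(x, y) \<in> \<sigma>" "x \<in> G" "z \<in> G" for x y z
    using congruence_psgD(5)[OF \<sigma> that(1)] that e(6) unfolding mul by metis
  have right: "(x \<otimes>\<^bsub>?H\<^esub> z, y \<otimes>\<^bsub>?H\<^esub> z) \<in> \<sigma>" if "(x, y) \<in> \<sigma>" "x \<in> G" "z \<in> G" for x y z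
    using congruence_psgD(6)[OF \<sigma> that(1)] that e(6) unfolding mul by metis
  have "subgroup ?N ?H"
  proof
    show "?N \<subseteq> carrier ?H" using car by auto
    show "\<one>\<^bsub>?H\<^esub> \<in> ?N" using e(1,2) congruence_psg_refl[OF \<sigma>] by simp
  next
    fix x y assume xy: "x \<in> ?N" "y \<in> ?N"
    then have "(x, x \<otimes>\<^bsub>?H\<^esub> y) \<in> \<sigma>" using left[of "\<one>\<^bsub>?H\<^esub>" y x] e(1) car by simp
    then show "x \<otimes>\<^bsub>?H\<^esub> y \<in> ?N"
      using xy congruence_psg_trans[OF \<sigma>] m_closed[of x y] car by auto
  next
    fix x assume x: "x \<in> ?N"
    then have i: "inv\<^bsub>?H\<^esub> x \<in> G" using inv_closed[of x] car by simp
    then have "(inv\<^bsub>?H\<^esub> x, \<one>\<^bsub>?H\<^esub>) \<in> \<sigma>" using left[of "\<one>\<^bsub>?H\<^esub>" x "inv\<^bsub>?H\<^esub> x"] x e(1) car by simp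
    then show "inv\<^bsub>?H\<^esub> x \<in> ?N" using i congruence_psg_sym[OF \<sigma>] by simp
  qed
  moreover have "x \<otimes>\<^bsub>?H\<^esub> h \<otimes>\<^bsub>?H\<^esub> inv\<^bsub>?H\<^esub> x \<in> ?N" if "x \<in> carrier ?H" "h \<in> ?N" for x h
  proof -
    have i: "inv\<^bsub>?H\<^esub> x \<in> G" "x \<in> G" "h \<in> G" using that car inv_closed[of x] by auto
    have "(x, x \<otimes>\<^bsub>?H\<^esub> h) \<in> \<sigma>" using left[of "\<one>\<^bsub>?H\<^esub>" h x] that e(1) car by simp
    then have "(\<one>\<^bsub>?H\<^esub>, x \<otimes>\<^bsub>?H\<^esub> h \<otimes>\<^bsub>?H\<^esub> inv\<^bsub>?H\<^esub> x) \<in> \<sigma>"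
      using right[of x "x \<otimes>\<^bsub>?H\<^esub> h" "inv\<^bsub>?H\<^esub> x"] that i car by simp
    moreover have "x \<otimes>\<^bsub>?H\<^esub> h \<otimes>\<^bsub>?H\<^esub> inv\<^bsub>?H\<^esub> x \<in> G"
      using i car m_closed by simp
    ultimately show ?thesis by simp
  qed
  ultimately show ?thesis unfolding normal_inv_iff by blast
qed

text \<open>Both elements are related to \<open>e\<close>. This supplies the hypothesis on
  \<open>N\<close> in \<open>nu_subset_congruence\<close>.\<close>

lemma congruence_class_related:
  "congruence_psg S \<sigma> \<Longrightarrow> N \<subseteq> {g \<in> G. (e, g) \<in> \<sigma>} \<Longrightarrow> x \<in> N \<Longrightarrow> y \<in> N \<Longrightarrow> (x, y) \<in> \<sigma>"
  using congruence_psg_sym congruence_psg_trans by (metis (no_types, lifting) CollectD subsetD)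

lemma nu_mono: "M \<subseteq> N \<Longrightarrow> nu S D M \<subseteq> nu S D N"
  unfolding nu_def Let_def by blast

section \<open>The correspondence between congruences inside \<open>green_H\<close> and
  NZ-tuples\<close>

theorem proposition10p5:
  fixes S :: "('a, 'c) psg"
    and Q :: "'q set"
    and D G :: "'q \<Rightarrow> 'a set"
  assumes "partial_semigroup S" and "stable_psg S" and "regular_psg S"
    and "bij_betw D Q (elems S // green_J S)"
    and "\<And>q. q \<in> Q \<Longrightarrow> group_H_class S (G q) \<and> G q \<subseteq> D q"
  shows "Cong_H S = {Theta S Q D N | N. NZ_tuple S Q D G N}"
proof
  note S = assms(1) and st = assms(2)
  have G: "group_H_class S (G q)" "G q \<subseteq> D q" if "q \<in> Q" for q using assms(5) that by auto
  have Dq: "D q \<in> elems S // green_J S" if "q \<in> Q" for q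
    using assms(4) that by (auto simp: bij_betw_def)
  have DJ: "D q = green_J S `` {x}" if "q \<in> Q" "x \<in> D q" for q x
    using Dq[OF that(1)] that(2) equiv_J[OF S]
    by (metis Image_singleton_iff equiv_class_eq_iff quotientE)
  have Dex: "\<exists>q\<in>Q. x \<in> D q" if "x \<in> elems S" for x
  proof -
    have "green_J S `` {x} \<in> D ` Q"
      using assms(4) that by (auto simp: bij_betw_def quotient_def)
    moreover have "x \<in> green_J S `` {x}" using equiv_class_self[OF equiv_J[OF S] that] .
    ultimately show ?thesis by auto
  qed
  have Duniq: "p = q" if "p \<in> Q" "q \<in> Q" "x \<in> D p" "x \<in> D q" for p q x
    using DJ[of p x] DJ[of q x] that assms(4) by (auto simp: bij_betw_def inj_on_def)
  have DS: "D q \<subseteq> elems S" if "q \<in> Q" for q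
    using in_quotient_imp_subset[OF equiv_J[OF S] Dq[OF that]] .

  show "Cong_H S \<subseteq> {Theta S Q D N | N. NZ_tuple S Q D G N}"
  proof
    fix \<sigma> assume "\<sigma> \<in> Cong_H S"
    then have \<sigma>: "congruence_psg S \<sigma>" "\<sigma> \<subseteq> green_H S" by (auto simp: Cong_H_def)
    \<comment> \<open>The tuple is read off from \<open>\<sigma>\<close>: in each
      \<open>G q\<close>, the class of the identity.\<close>
    define N where "N q = {g \<in> G q. (\<one>\<^bsub>H_group S (G q)\<^esub>, g) \<in> \<sigma>}" for q
    have nu\<sigma>: "nu S (D q) (N q) \<subseteq> \<sigma>" for q
      using nu_subset_congruence[OF S \<sigma>(1)] congruence_class_related[OF \<sigma>(1), of "N q"]
      unfolding N_def by blast
    have "NZ_tuple S Q D G N"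
      unfolding NZ_tuple_def
    proof (intro conjI ballI impI)
      fix q assume q: "q \<in> Q"
      show "N q \<lhd> H_group S (G q)"
        unfolding N_def using congruence_class_normal[OF S G(1)[OF q] \<sigma>(1)] .
      show "N q \<subseteq> Z_sub S (G q)"
        unfolding N_def Z_sub_def using zeta_greatest(3)[OF S \<sigma>] by blast
    next
      fix p q
      \<comment> \<open>The congruence generated by \<open>nu S (D q) (N q)\<close> stays inside
        \<open>\<sigma>\<close>, so whatever it relates to the identity of \<open>G p\<close> is
        already in \<open>N p\<close>.\<close>
      show "down S (D q) (N q) (G p) \<subseteq> N p"
        using cong_gen_least[OF \<sigma>(1) nu\<sigma>[of q]] unfolding down_def N_def[of p] by blast
    qed
    moreover have "\<sigma> = Theta S Q D N"
    proof
      show "Theta S Q D N \<subseteq> \<sigma>" unfolding Theta_def using nu\<sigma> by blast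
      show "\<sigma> \<subseteq> Theta S Q D N"
      proof (rule subrelI)
        fix u v assume uv: "(u, v) \<in> \<sigma>"
        then obtain q where q: "q \<in> Q" "u \<in> D q"
          using Dex congruence_psgD(1)[OF \<sigma>(1) uv] by blast
        then have "(u, v) \<in> nu S (D q) (N q)"
          unfolding N_def using congruence_in_nu[OF S st G(1) Dq G(2) \<sigma> uv] by blast
        then show "(u, v) \<in> Theta S Q D N" unfolding Theta_def using q by blast
      qed
    qed
    ultimately show "\<sigma> \<in> {Theta S Q D N | N. NZ_tuple S Q D G N}" by blast
  qed

  show "{Theta S Q D N | N. NZ_tuple S Q D G N} \<subseteq> Cong_H S"
  proof clarify
    fix N assume NZ: "NZ_tuple S Q D G N"
    define \<Theta> where "\<Theta> = Theta S Q D N"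
    \<comment> \<open>\<open>\<Theta>\<close> is compared, class by class, with the congruences
      generated by single members of the tuple.\<close>
    define \<sigma> where "\<sigma> q = cong_gen S (nu S (D q) (N q))" for q
    \<comment> \<open>This is where \<open>N q\<close> being inside \<open>Z_sub\<close> enters:
      \<open>zeta S\<close> contains the generators, so each \<open>\<sigma> q\<close> is a genuine
      congruence inside \<open>green_H\<close>.\<close>
    have nu\<zeta>: "nu S (D q) (N q) \<subseteq> zeta S" if "q \<in> Q" for q
    proof -
      have "N q \<subseteq> {g \<in> G q. (\<one>\<^bsub>H_group S (G q)\<^esub>, g) \<in> zeta S}"
        using NZ that unfolding NZ_tuple_def Z_sub_def by blast
      from congruence_class_related[OF zeta_greatest(1)[OF S] this] show ?thesis
        by (rule nu_subset_congruence[OF S zeta_greatest(1)[OF S]])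
    qed
    have \<sigma>: "congruence_psg S (\<sigma> q)" "\<sigma> q \<subseteq> green_H S" "nu S (D q) (N q) \<subseteq> \<sigma> q"
      if "q \<in> Q" for q
      unfolding \<sigma>_def
      using cong_gen_congruence[OF zeta_greatest(1)[OF S] nu\<zeta>[OF that]] cong_gen_incl
        cong_gen_least[OF zeta_greatest(1)[OF S] nu\<zeta>[OF that]] zeta_greatest(2)[OF S] by blast+
    \<comment> \<open>On a class \<open>D p\<close> below \<open>D q\<close>,
      \<open>congruence_in_nu\<close> places \<open>\<sigma> q\<close> inside \<open>nu\<close> of
      the pushed-down subgroup, which the NZ condition bounds by \<open>N p\<close>.\<close>
    have \<sigma>\<Theta>: "(u, v) \<in> nu S (D p) (N p)"
      if "p \<in> Q" "q \<in> Q" "J_class_le S (D p) (D q)" "(u, v) \<in> \<sigma> q" "u \<in> D p" for p q u v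
    proof -
      have "(u, v) \<in> nu S (D p) (down S (D q) (N q) (G p))"
        unfolding down_def \<sigma>_def[symmetric]
        using congruence_in_nu[OF S st G(1) Dq G(2) \<sigma>(1,2)] that by blast
      moreover have "down S (D q) (N q) (G p) \<subseteq> N p"
        using NZ that unfolding NZ_tuple_def by blast
      ultimately show ?thesis using nu_mono by blast
    qed
    have le: "J_class_le S (D p) (D q)"
      if "p \<in> Q" "q \<in> Q" "x \<in> D p" "y \<in> D q" "Inl x \<in> two_sided_ideal S y" for p q x y
      unfolding J_class_le_def using that DJ DS by blast
    \<comment> \<open>The element \<open>w\<close> only witnesses that the class of \<open>u\<close>
      lies below \<open>D q\<close>.\<close>
    have \<sigma>I: "(u, v) \<in> \<Theta>"
      if w: "q \<in> Q" "w \<in> D q" "Inl u \<in> two_sided_ideal S w" "(u, v) \<in> \<sigma> q" for q u v w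
    proof -
      obtain p where p: "p \<in> Q" "u \<in> D p"
        using Dex congruence_psgD(1)[OF \<sigma>(1)[OF w(1)] w(4)] by blast
      have "(u, v) \<in> nu S (D p) (N p)"
        using \<sigma>\<Theta>[OF p(1) w(1) le[OF p(1) w(1) p(2) w(2,3)] w(4) p(2)] .
      then show ?thesis unfolding \<Theta>_def Theta_def using p(1) by blast
    qed
    \<comment> \<open>Together with \<open>\<Theta>I\<close> below, this shows that
      \<open>\<Theta>\<close> and \<open>\<sigma> q\<close> agree on \<open>D q\<close>, so the
      equivalence axioms carry over.\<close>
    have \<Theta>E: "\<exists>q\<in>Q. x \<in> D q \<and> y \<in> D q \<and> (x, y) \<in> \<sigma> q" if xy: "(x, y) \<in> \<Theta>" for x y
    proof -
      obtain q where q: "q \<in> Q" "(x, y) \<in> nu S (D q) (N q)"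
        using xy unfolding \<Theta>_def Theta_def by blast
      moreover from q(2) have "x \<in> D q" "y \<in> D q" by (auto simp: nu_def Let_def)
      ultimately show ?thesis using \<sigma>(3) by blast
    qed
    have \<Theta>I: "(x, y) \<in> \<Theta>" if "q \<in> Q" "x \<in> D q" "(x, y) \<in> \<sigma> q" for q x y
      using \<sigma>I[OF that(1,2) _ that(3)] two_sided_self[OF S] that DS by blast
    have "equiv (elems S) \<Theta>"
    proof (intro equivI refl_onI symI transI)
      show "\<Theta> \<subseteq> elems S \<times> elems S"
        using \<Theta>E DS by fast
      show "(x, x) \<in> \<Theta>" if "x \<in> elems S" for x
        using Dex[OF that] \<Theta>I congruence_psg_refl[OF \<sigma>(1) that] by blast
      show "(y, x) \<in> \<Theta>" if "(x, y) \<in> \<Theta>" for x y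
        using \<Theta>E[OF that] \<Theta>I congruence_psg_sym[OF \<sigma>(1)] by blast
      \<comment> \<open>The shared element \<open>y\<close> forces the two indices to be equal by
        \<open>Duniq\<close>, so transitivity takes place in a single
        \<open>\<sigma> q\<close>.\<close>
      show "(x, z) \<in> \<Theta>" if "(x, y) \<in> \<Theta>" "(y, z) \<in> \<Theta>" for x y z
        using \<Theta>E[OF that(1)] \<Theta>E[OF that(2)] Duniq \<Theta>I congruence_psg_trans[OF \<sigma>(1)] by metis
    qed
    moreover have "dd S x = dd S y \<and> rr S x = rr S y \<and>
        (\<forall>a\<in>elems S. (composable S a x \<longrightarrow> (a \<cdot>\<^bsub>S\<^esub> x, a \<cdot>\<^bsub>S\<^esub> y) \<in> \<Theta>) \<and>
           (composable S x a \<longrightarrow> (x \<cdot>\<^bsub>S\<^esub> a, y \<cdot>\<^bsub>S\<^esub> a) \<in> \<Theta>))" if xy: "(x, y) \<in> \<Theta>" for x y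
    proof -
      obtain q where q: "q \<in> Q" "x \<in> D q" "(x, y) \<in> \<sigma> q" using \<Theta>E[OF xy] by blast
      note c = congruence_psgD[OF \<sigma>(1)[OF q(1)] q(3)]
      \<comment> \<open>The products are related by \<open>\<sigma> q\<close> and may fall into a
        lower class; \<open>\<sigma>I\<close> with \<open>w = x\<close> brings the pair back into
        \<open>\<Theta>\<close>.\<close>
      show ?thesis
        using c(3-6) \<sigma>I[OF q(1,2)] two_sided_mult[OF S c(1)] unfolding composable_def by metis
    qed
    ultimately have "congruence_psg S \<Theta>"
      unfolding congruence_psg_def by (intro conjI ballI case_prodI2) auto
    moreover have "\<Theta> \<subseteq> green_H S" using \<Theta>E \<sigma>(2) by fast
    ultimately show "Theta S Q D N \<in> Cong_H S" by (simp add: Cong_H_def \<Theta>_def)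
  qed
qed

end
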